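(* Let $G=(V,E)$ be a digraph. Then $G^{\top\bot}$ has the Hobby–McKenzie property if and only if $G$ has the Hobby–McKenzie property.
   Context: Digraphs are finite and loopless. $G^\top$ is the digraph on $V\cup\{\top\}$ with edges $E\cup\{(v,\top):v\in V\}$; $G^\bot$ is the digraph on $V\cup\{\bot\}$ with edges $E\cup\{(\bot,v):v\in V\}$; $G^{\top\bot}=(G^\top)^\bot$. A polymorphism is a map $f:V^k\to V$ with $(f(a_1,\dots,a_k),f(b_1,\dots,b_k))\in E$ whenever all $(a_i,b_i)\in E$. A digraph has the Hobby–McKenzie property if there are $n\ge0$ and idempotent ternary polymorphisms $d_0,\dots,d_n,p,e_0,\dots,e_n$ satisfying, for all vertices: $x=d_0(x,y,z)$, $e_n(x,y,z)=z$; $d_i(x,y,y)=d_{i+1}(x,y,y)$ and $e_i(x,y,y)=e_{i+1}(x,y,y)$ for even $i<n$; $d_i(x,x,y)=d_{i+1}(x,x,y)$ and $e_i(x,x,y)=e_{i+1}(x,x,y)$ for odd $i<n$; $d_n(x,y,y)=p(x,y,y)$ and $p(x,x,y)=e_0(x,x,y)$; $d_i(x,y,x)=d_{i+1}(x,y,x)$ for odd $i<n$ and $e_j(x,y,x)=e_{j+1}(x,y,x)$ for even $j<n$. *)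

theory Defs
  imports Main
begin

definition digraph :: "'a set \<Rightarrow> ('a \<times> 'a) set \<Rightarrow> bool" where
  "digraph V E \<longleftrightarrow> finite V \<and> E \<subseteq> V \<times> V \<and> (\<forall>v. (v, v) \<notin> E)"

definition top_ext_V :: "'a set \<Rightarrow> 'a option set" where
  "top_ext_V V = Some ` V \<union> {None}"
definition top_ext_E :: "'a set \<Rightarrow> ('a \<times> 'a) set \<Rightarrow> ('a option \<times> 'a option) set" where
  "top_ext_E V E = {(Some a, Some b) | a b. (a, b) \<in> E} \<union> {(Some v, None) | v. v \<in> V}"

definition bot_ext_V :: "'a set \<Rightarrow> 'a option set" where
  "bot_ext_V V = Some ` V \<union> {None}"
definition bot_ext_E :: "'a set \<Rightarrow> ('a \<times> 'a) set \<Rightarrow> ('a option \<times> 'a option) set" where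
  "bot_ext_E V E = {(Some a, Some b) | a b. (a, b) \<in> E} \<union> {(None, Some v) | v. v \<in> V}"

definition topbot_V :: "'a set \<Rightarrow> 'a option option set" where
  "topbot_V V = bot_ext_V (top_ext_V V)"
definition topbot_E :: "'a set \<Rightarrow> ('a \<times> 'a) set \<Rightarrow> ('a option option \<times> 'a option option) set" where
  "topbot_E V E = bot_ext_E (top_ext_V V) (top_ext_E V E)"

definition polymorphism3 :: "'a set \<Rightarrow> ('a \<times> 'a) set \<Rightarrow> ('a \<Rightarrow> 'a \<Rightarrow> 'a \<Rightarrow> 'a) \<Rightarrow> bool" where
  "polymorphism3 V E f \<longleftrightarrow>
     (\<forall>x\<in>V. \<forall>y\<in>V. \<forall>z\<in>V. f x y z \<in> V) \<and>
     (\<forall>a1 a2 a3 b1 b2 b3. (a1, b1) \<in> E \<and> (a2, b2) \<in> E \<and> (a3, b3) \<in> E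
        \<longrightarrow> (f a1 a2 a3, f b1 b2 b3) \<in> E)"

definition idempotent3 :: "'a set \<Rightarrow> ('a \<Rightarrow> 'a \<Rightarrow> 'a \<Rightarrow> 'a) \<Rightarrow> bool" where
  "idempotent3 V f \<longleftrightarrow> (\<forall>x\<in>V. f x x x = x)"

definition hobby_mckenzie :: "'a set \<Rightarrow> ('a \<times> 'a) set \<Rightarrow> bool" where
  "hobby_mckenzie V E \<longleftrightarrow>
    (\<exists>(n::nat) (d :: nat \<Rightarrow> 'a \<Rightarrow> 'a \<Rightarrow> 'a \<Rightarrow> 'a) p (e :: nat \<Rightarrow> 'a \<Rightarrow> 'a \<Rightarrow> 'a \<Rightarrow> 'a).
      (\<forall>i\<le>n. polymorphism3 V E (d i) \<and> idempotent3 V (d i)) \<and>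
      polymorphism3 V E p \<and> idempotent3 V p \<and>
      (\<forall>i\<le>n. polymorphism3 V E (e i) \<and> idempotent3 V (e i)) \<and>
      (\<forall>x\<in>V. \<forall>y\<in>V. \<forall>z\<in>V.
         x = d 0 x y z \<and> e n x y z = z \<and>
         (\<forall>i<n. even i \<longrightarrow> d i x y y = d (Suc i) x y y \<and> e i x y y = e (Suc i) x y y) \<and>
         (\<forall>i<n. odd i \<longrightarrow> d i x x y = d (Suc i) x x y \<and> e i x x y = e (Suc i) x x y) \<and>
         d n x y y = p x y y \<and> p x x y = e 0 x x y \<and>
         (\<forall>i<n. odd i \<longrightarrow> d i x y x = d (Suc i) x y x) \<and>
         (\<forall>j<n. even j \<longrightarrow> e j x y x = e (Suc j) x y x)))"

end

(* Restriction: by idempotence every polymorphism of the extended digraph fixes \<top> and \<bottom>, hence it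
   preserves V, the set of vertices with an edge from \<bottom> and an edge to \<top>.

   Extension: a polymorphism f of G extends to one of the extended digraph by letting \<top> and \<bottom> be
   absorbing, but the resulting chain starts at the absorbing extension of the first projection
   and ends at that of the third, not at the projections themselves. One extra operation
   at each end repairs this: "if y = z then x else (absorbing extension of the first projection)"
   is still a polymorphism, agrees with the first projection on (x,y,y) and with the absorbing extension on
   (x,x,y) and (x,y,x); symmetrically at the other end. Two links are added on each side, so
   parities are preserved, except that the link closing the e-chain has the right parity only
   for even n; repeating the last d and e achieves that. *)

theory Submission
  imports Defs
begin

section \<open>The extended digraph: \<open>None\<close> is \<bottom>, \<open>Some None\<close> is
  \<top>, \<open>Some (Some v)\<close> is an original vertex\<close>

lemma topbot_V_simps [simp]:
  "None \<in> topbot_V V"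
  "Some None \<in> topbot_V V"
  "Some (Some v) \<in> topbot_V V \<longleftrightarrow> v \<in> V"
  by (auto simp: topbot_V_def bot_ext_V_def top_ext_V_def)

lemma topbot_V_cases:
  assumes "u \<in> topbot_V V"
  obtains "u = None" | "u = Some None" | v where "u = Some (Some v)" "v \<in> V"
  using assms by (auto simp: topbot_V_def bot_ext_V_def top_ext_V_def)

lemma topbot_E_simps [simp]:
  "(u, None) \<notin> topbot_E V E"
  "(Some None, u) \<notin> topbot_E V E"
  "(None, Some None) \<in> topbot_E V E"
  "(None, Some (Some v)) \<in> topbot_E V E \<longleftrightarrow> v \<in> V"
  "(Some (Some v), Some None) \<in> topbot_E V E \<longleftrightarrow> v \<in> V"
  "(Some (Some v), Some (Some w)) \<in> topbot_E V E \<longleftrightarrow> (v, w) \<in> E"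
  by (auto simp: topbot_E_def bot_ext_E_def top_ext_E_def top_ext_V_def)

lemma topbot_E_cases:
  assumes "(u, w) \<in> topbot_E V E"
  obtains "u = None" "w = Some None"
  | b where "u = None" "w = Some (Some b)" "b \<in> V"
  | a where "u = Some (Some a)" "w = Some None" "a \<in> V"
  | a b where "u = Some (Some a)" "w = Some (Some b)" "(a, b) \<in> E"
  using assms by (auto simp: topbot_E_def bot_ext_E_def top_ext_E_def top_ext_V_def)

section \<open>Restriction of polymorphisms to the original vertices\<close>

text \<open>The decoding by \<open>the\<close> is meaningful only when the value is an original
  vertex; \<open>polymorphism3_topbot_inner\<close> guarantees this for idempotent
  polymorphisms.\<close>

definition restrict3 ::
  "('a option option \<Rightarrow> 'a option option \<Rightarrow> 'a option option \<Rightarrow> 'a option option) \<Rightarrow> 'a \<Rightarrow> 'a \<Rightarrow> 'a \<Rightarrow> 'a" where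
  "restrict3 f x y z = the (the (f (Some (Some x)) (Some (Some y)) (Some (Some z))))"

lemma polymorphism3_topbot_inner:
  assumes f: "polymorphism3 (topbot_V V) (topbot_E V E) f" "idempotent3 (topbot_V V) f"
    and xyz: "x \<in> V" "y \<in> V" "z \<in> V"
  shows "Some (Some (restrict3 f x y z)) = f (Some (Some x)) (Some (Some y)) (Some (Some z))"
    and "restrict3 f x y z \<in> V"
proof -
  let ?w = "f (Some (Some x)) (Some (Some y)) (Some (Some z))"
  have "(f None None None, ?w) \<in> topbot_E V E"
    and "(?w, f (Some None) (Some None) (Some None)) \<in> topbot_E V E"
    using f(1) xyz unfolding polymorphism3_def by simp_all
  moreover have "f None None None = None" "f (Some None) (Some None) (Some None) = Some None"
    using f(2) unfolding idempotent3_def by simp_all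
  ultimately have "(None, ?w) \<in> topbot_E V E" "(?w, Some None) \<in> topbot_E V E"
    by simp_all
  then obtain v where "?w = Some (Some v)" "v \<in> V"
    by (auto elim!: topbot_E_cases)
  then show "Some (Some (restrict3 f x y z)) = ?w" "restrict3 f x y z \<in> V"
    by (simp_all add: restrict3_def)
qed

lemma idempotent3_restrict3:
  assumes "idempotent3 (topbot_V V) f"
  shows "idempotent3 V (restrict3 f)"
  using assms by (simp add: idempotent3_def restrict3_def)

lemma polymorphism3_restrict3:
  assumes E: "E \<subseteq> V \<times> V"
    and f: "polymorphism3 (topbot_V V) (topbot_E V E) f" "idempotent3 (topbot_V V) f"
  shows "polymorphism3 V E (restrict3 f)"
  unfolding polymorphism3_def
proof (intro conjI ballI allI impI)
  show "restrict3 f x y z \<in> V" if "x \<in> V" "y \<in> V" "z \<in> V" for x y z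
    using polymorphism3_topbot_inner(2)[OF f that] .
next
  fix a1 a2 a3 b1 b2 b3
  assume ab: "(a1, b1) \<in> E \<and> (a2, b2) \<in> E \<and> (a3, b3) \<in> E"
  then have V: "a1 \<in> V" "a2 \<in> V" "a3 \<in> V" "b1 \<in> V" "b2 \<in> V" "b3 \<in> V"
    using E by auto
  have "(f (Some (Some a1)) (Some (Some a2)) (Some (Some a3)),
         f (Some (Some b1)) (Some (Some b2)) (Some (Some b3))) \<in> topbot_E V E"
    using f(1) ab unfolding polymorphism3_def by simp
  then have "(Some (Some (restrict3 f a1 a2 a3)), Some (Some (restrict3 f b1 b2 b3))) \<in> topbot_E V E"
    using polymorphism3_topbot_inner(1)[OF f V(1-3)] polymorphism3_topbot_inner(1)[OF f V(4-6)] by simp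
  then show "(restrict3 f a1 a2 a3, restrict3 f b1 b2 b3) \<in> E"
    by simp
qed

lemma hobby_mckenzie_restrict:
  assumes E: "E \<subseteq> V \<times> V" and HM: "hobby_mckenzie (topbot_V V) (topbot_E V E)"
  shows "hobby_mckenzie V E"
proof -
  let ?W = "topbot_V V" and ?F = "topbot_E V E"
  obtain n d p e where
    ops: "\<forall>i\<le>n. polymorphism3 ?W ?F (d i) \<and> idempotent3 ?W (d i)"
         "polymorphism3 ?W ?F p" "idempotent3 ?W p"
         "\<forall>i\<le>n. polymorphism3 ?W ?F (e i) \<and> idempotent3 ?W (e i)"
    and eqs: "\<forall>x\<in>?W. \<forall>y\<in>?W. \<forall>z\<in>?W.
         x = d 0 x y z \<and> e n x y z = z \<and>
         (\<forall>i<n. even i \<longrightarrow> d i x y y = d (Suc i) x y y \<and> e i x y y = e (Suc i) x y y) \<and>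
         (\<forall>i<n. odd i \<longrightarrow> d i x x y = d (Suc i) x x y \<and> e i x x y = e (Suc i) x x y) \<and>
         d n x y y = p x y y \<and> p x x y = e 0 x x y \<and>
         (\<forall>i<n. odd i \<longrightarrow> d i x y x = d (Suc i) x y x) \<and>
         (\<forall>j<n. even j \<longrightarrow> e j x y x = e (Suc j) x y x)"
    using HM unfolding hobby_mckenzie_def by (elim exE conjE) (rule that; assumption)
  show ?thesis
    unfolding hobby_mckenzie_def
  proof (intro exI conjI)
    show "\<forall>i\<le>n. polymorphism3 V E (restrict3 (d i)) \<and> idempotent3 V (restrict3 (d i))"
      "polymorphism3 V E (restrict3 p)" "idempotent3 V (restrict3 p)"
      "\<forall>i\<le>n. polymorphism3 V E (restrict3 (e i)) \<and> idempotent3 V (restrict3 (e i))"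
      using ops E by (auto intro: polymorphism3_restrict3 idempotent3_restrict3)
  next
    show "\<forall>x\<in>V. \<forall>y\<in>V. \<forall>z\<in>V. x = restrict3 (d 0) x y z \<and> restrict3 (e n) x y z = z \<and>
         (\<forall>i<n. even i \<longrightarrow> restrict3 (d i) x y y = restrict3 (d (Suc i)) x y y \<and>
            restrict3 (e i) x y y = restrict3 (e (Suc i)) x y y) \<and>
         (\<forall>i<n. odd i \<longrightarrow> restrict3 (d i) x x y = restrict3 (d (Suc i)) x x y \<and>
            restrict3 (e i) x x y = restrict3 (e (Suc i)) x x y) \<and>
         restrict3 (d n) x y y = restrict3 p x y y \<and> restrict3 p x x y = restrict3 (e 0) x x y \<and>
         (\<forall>i<n. odd i \<longrightarrow> restrict3 (d i) x y x = restrict3 (d (Suc i)) x y x) \<and>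
         (\<forall>j<n. even j \<longrightarrow> restrict3 (e j) x y x = restrict3 (e (Suc j)) x y x)" (is "\<forall>x\<in>V. \<forall>y\<in>V. \<forall>z\<in>V. ?eqs x y z")
    proof (intro ballI)
      fix x y z assume V: "x \<in> V" "y \<in> V" "z \<in> V"
      have "Some (Some x) \<in> ?W" "Some (Some y) \<in> ?W" "Some (Some z) \<in> ?W"
        using V by simp_all
      note inst = bspec[OF bspec[OF bspec[OF eqs this(1)] this(2)] this(3)]
      have "d 0 (Some (Some x)) (Some (Some y)) (Some (Some z)) = Some (Some x)"
        using inst[THEN conjunct1] by (rule sym)
      \<comment> \<open>Equal values stay equal under \<open>the\<close>, so every identity on
        embedded vertices passes to the restrictions by unfolding.\<close>
      with inst[THEN conjunct2] show "?eqs x y z"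
        unfolding restrict3_def by simp
    qed
  qed
qed

section \<open>Absorbing extensions\<close>

text \<open>On triples containing both \<open>\<top>\<close> and \<open>\<bottom>\<close> the value is irrelevant for
  being a polymorphism, as no edge of the cube meets them.\<close>
definition absorb3 ::
  "('a \<Rightarrow> 'a \<Rightarrow> 'a \<Rightarrow> 'a) \<Rightarrow> 'a option option \<Rightarrow> 'a option option \<Rightarrow> 'a option option \<Rightarrow> 'a option option" where
  "absorb3 f x y z =
    (if Some None \<in> {x, y, z} then Some None
     else if None \<in> {x, y, z} then None
     else Some (Some (f (the (the x)) (the (the y)) (the (the z)))))"

lemma idempotent3_absorb3:
  assumes "idempotent3 V f"
  shows "idempotent3 (topbot_V V) (absorb3 f)"
  using assms by (auto simp: idempotent3_def absorb3_def elim!: topbot_V_cases)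

lemma absorb3_in_topbot_V:
  assumes "polymorphism3 V E f" "x \<in> topbot_V V" "y \<in> topbot_V V" "z \<in> topbot_V V"
  shows "absorb3 f x y z \<in> topbot_V V"
  using assms by (auto simp: polymorphism3_def absorb3_def elim!: topbot_V_cases)

text \<open>No edge starts in \<top> or ends in \<bottom>. So the source triple has value \<bottom>
  or an original vertex, and the target triple has value \<top> or an original vertex. If both
  values are original, all three edges lie in \<open>E\<close> and \<open>f\<close> preserves them;
  otherwise the pair leaves \<bottom> or enters \<top> and is an edge anyway.\<close>

lemma polymorphism3_absorb3:
  assumes E: "E \<subseteq> V \<times> V" and f: "polymorphism3 V E f"
  shows "polymorphism3 (topbot_V V) (topbot_E V E) (absorb3 f)"
  unfolding polymorphism3_def
proof (intro conjI ballI allI impI; (elim conjE)?)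
  show "absorb3 f x y z \<in> topbot_V V"
    if "x \<in> topbot_V V" "y \<in> topbot_V V" "z \<in> topbot_V V" for x y z
    using absorb3_in_topbot_V[OF f that] .
next
  fix a1 a2 a3 b1 b2 b3
  assume ab: "(a1, b1) \<in> topbot_E V E" "(a2, b2) \<in> topbot_E V E" "(a3, b3) \<in> topbot_E V E"
  have EV: "(a, b) \<in> E \<Longrightarrow> a \<in> V" "(a, b) \<in> E \<Longrightarrow> b \<in> V" for a b
    using E by auto
  have fV: "x \<in> V \<Longrightarrow> y \<in> V \<Longrightarrow> z \<in> V \<Longrightarrow> f x y z \<in> V" for x y z
    using f by (simp add: polymorphism3_def)
  have fE: "(x, x') \<in> E \<Longrightarrow> (y, y') \<in> E \<Longrightarrow> (z, z') \<in> E \<Longrightarrow> (f x y z, f x' y' z') \<in> E" for x y z x' y' z'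
    using f by (simp add: polymorphism3_def)
  show "(absorb3 f a1 a2 a3, absorb3 f b1 b2 b3) \<in> topbot_E V E"
    using ab
    by (elim topbot_E_cases) (simp_all add: absorb3_def EV fV fE)
qed

text \<open>On triples that meet \<top> or \<bottom> the value of \<open>absorb3 f\<close> does not
  depend on \<open>f\<close>, so an identity between \<open>f\<close> and \<open>g\<close> has to be
  checked on \<open>V\<close> only. The next two lemmas rest on the same remark.\<close>

lemma absorb3_eq_xyy:
  assumes "\<And>u v. u \<in> V \<Longrightarrow> v \<in> V \<Longrightarrow> f u v v = g u v v" "x \<in> topbot_V V" "y \<in> topbot_V V"
  shows "absorb3 f x y y = absorb3 g x y y"
  using assms by (auto simp: absorb3_def elim!: topbot_V_cases)

lemma absorb3_eq_xxy:
  assumes "\<And>u v. u \<in> V \<Longrightarrow> v \<in> V \<Longrightarrow> f u u v = g u u v" "x \<in> topbot_V V" "y \<in> topbot_V V"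
  shows "absorb3 f x x y = absorb3 g x x y"
  using assms by (auto simp: absorb3_def elim!: topbot_V_cases)

lemma absorb3_eq_xyx:
  assumes "\<And>u v. u \<in> V \<Longrightarrow> v \<in> V \<Longrightarrow> f u v u = g u v u" "x \<in> topbot_V V" "y \<in> topbot_V V"
  shows "absorb3 f x y x = absorb3 g x y x"
  using assms by (auto simp: absorb3_def elim!: topbot_V_cases)

section \<open>Interpolating between projections and their absorbing extensions\<close>

definition proj1_unless :: "('b \<Rightarrow> 'b \<Rightarrow> 'b \<Rightarrow> 'b) \<Rightarrow> 'b \<Rightarrow> 'b \<Rightarrow> 'b \<Rightarrow> 'b" where
  "proj1_unless g x y z = (if y = z then x else g x y z)"

definition proj3_unless :: "('b \<Rightarrow> 'b \<Rightarrow> 'b \<Rightarrow> 'b) \<Rightarrow> 'b \<Rightarrow> 'b \<Rightarrow> 'b \<Rightarrow> 'b" where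
  "proj3_unless g x y z = (if x = y then z else g x y z)"

text \<open>Since \<open>f\<close> is the first projection on \<open>V\<close>, the source triple of
  an edge is sent to \<open>a1\<close> or \<bottom>, and the target triple to \<open>b1\<close> or
  \<top>, whichever branch applies. All four combinations are edges as soon as
  \<open>(a1, b1)\<close> is one. The third coordinate is treated likewise below.\<close>

lemma polymorphism3_proj1_unless:
  assumes E: "E \<subseteq> V \<times> V" and f: "polymorphism3 V E f"
    and proj: "\<And>x y z. x \<in> V \<Longrightarrow> y \<in> V \<Longrightarrow> z \<in> V \<Longrightarrow> f x y z = x"
  shows "polymorphism3 (topbot_V V) (topbot_E V E) (proj1_unless (absorb3 f))"
  unfolding polymorphism3_def
proof (intro conjI ballI allI impI; (elim conjE)?)
  show "proj1_unless (absorb3 f) x y z \<in> topbot_V V"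
    if "x \<in> topbot_V V" "y \<in> topbot_V V" "z \<in> topbot_V V" for x y z
    using absorb3_in_topbot_V[OF f that] that by (simp add: proj1_unless_def)
next
  fix a1 a2 a3 b1 b2 b3
  assume ab: "(a1, b1) \<in> topbot_E V E" "(a2, b2) \<in> topbot_E V E" "(a3, b3) \<in> topbot_E V E"
  have EV: "(a, b) \<in> E \<Longrightarrow> a \<in> V" "(a, b) \<in> E \<Longrightarrow> b \<in> V" for a b
    using E by auto
  show "(proj1_unless (absorb3 f) a1 a2 a3, proj1_unless (absorb3 f) b1 b2 b3) \<in> topbot_E V E"
    using ab
    by (elim topbot_E_cases) (simp_all add: absorb3_def proj1_unless_def EV proj)
qed

lemma polymorphism3_proj3_unless:
  assumes E: "E \<subseteq> V \<times> V" and f: "polymorphism3 V E f"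
    and proj: "\<And>x y z. x \<in> V \<Longrightarrow> y \<in> V \<Longrightarrow> z \<in> V \<Longrightarrow> f x y z = z"
  shows "polymorphism3 (topbot_V V) (topbot_E V E) (proj3_unless (absorb3 f))"
  unfolding polymorphism3_def
proof (intro conjI ballI allI impI; (elim conjE)?)
  show "proj3_unless (absorb3 f) x y z \<in> topbot_V V"
    if "x \<in> topbot_V V" "y \<in> topbot_V V" "z \<in> topbot_V V" for x y z
    using absorb3_in_topbot_V[OF f that] that by (simp add: proj3_unless_def)
next
  fix a1 a2 a3 b1 b2 b3
  assume ab: "(a1, b1) \<in> topbot_E V E" "(a2, b2) \<in> topbot_E V E" "(a3, b3) \<in> topbot_E V E"
  have EV: "(a, b) \<in> E \<Longrightarrow> a \<in> V" "(a, b) \<in> E \<Longrightarrow> b \<in> V" for a b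
    using E by auto
  show "(proj3_unless (absorb3 f) a1 a2 a3, proj3_unless (absorb3 f) b1 b2 b3) \<in> topbot_E V E"
    using ab
    by (elim topbot_E_cases) (simp_all add: absorb3_def proj3_unless_def EV proj)
qed

lemma polymorphism3_proj:
  "polymorphism3 V E (\<lambda>x y z. x)" "polymorphism3 V E (\<lambda>x y z. z)"
  by (auto simp: polymorphism3_def)

section \<open>Chains of even length\<close>

locale hobby_mckenzie_chain =
  fixes V :: "'a set" and E :: "('a \<times> 'a) set" and n :: nat
    and d :: "nat \<Rightarrow> 'a \<Rightarrow> 'a \<Rightarrow> 'a \<Rightarrow> 'a" and p :: "'a \<Rightarrow> 'a \<Rightarrow> 'a \<Rightarrow> 'a" and e :: "nat \<Rightarrow> 'a \<Rightarrow> 'a \<Rightarrow> 'a \<Rightarrow> 'a"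
  assumes d_poly: "i \<le> n \<Longrightarrow> polymorphism3 V E (d i)" and d_idem: "i \<le> n \<Longrightarrow> idempotent3 V (d i)"
    and p_poly: "polymorphism3 V E p" and p_idem: "idempotent3 V p"
    and e_poly: "i \<le> n \<Longrightarrow> polymorphism3 V E (e i)" and e_idem: "i \<le> n \<Longrightarrow> idempotent3 V (e i)"
    and d_0: "\<lbrakk>x \<in> V; y \<in> V; z \<in> V\<rbrakk> \<Longrightarrow> d 0 x y z = x"
    and e_n: "\<lbrakk>x \<in> V; y \<in> V; z \<in> V\<rbrakk> \<Longrightarrow> e n x y z = z"
    and d_xyy: "\<lbrakk>i < n; even i; x \<in> V; y \<in> V\<rbrakk> \<Longrightarrow> d i x y y = d (Suc i) x y y"
    and e_xyy: "\<lbrakk>i < n; even i; x \<in> V; y \<in> V\<rbrakk> \<Longrightarrow> e i x y y = e (Suc i) x y y"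
    and d_xxy: "\<lbrakk>i < n; odd i; x \<in> V; y \<in> V\<rbrakk> \<Longrightarrow> d i x x y = d (Suc i) x x y"
    and e_xxy: "\<lbrakk>i < n; odd i; x \<in> V; y \<in> V\<rbrakk> \<Longrightarrow> e i x x y = e (Suc i) x x y"
    and d_p: "\<lbrakk>x \<in> V; y \<in> V\<rbrakk> \<Longrightarrow> d n x y y = p x y y"
    and p_e: "\<lbrakk>x \<in> V; y \<in> V\<rbrakk> \<Longrightarrow> p x x y = e 0 x x y"
    and d_xyx: "\<lbrakk>i < n; odd i; x \<in> V; y \<in> V\<rbrakk> \<Longrightarrow> d i x y x = d (Suc i) x y x"
    and e_xyx: "\<lbrakk>i < n; even i; x \<in> V; y \<in> V\<rbrakk> \<Longrightarrow> e i x y x = e (Suc i) x y x"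

text \<open>A repeated operation satisfies every link identity with itself, so a chain of odd length
  can be padded by one more copy of \<open>d n\<close> and of \<open>e n\<close>. The connections to
  \<open>p\<close> and the projections at both ends are kept.\<close>

lemma hobby_mckenzie_even_chain:
  assumes "hobby_mckenzie V E"
  shows "\<exists>n d p e. hobby_mckenzie_chain V E n d p e \<and> even n"
proof -
  obtain n d p e where
    ops: "\<forall>i\<le>n. polymorphism3 V E (d i) \<and> idempotent3 V (d i)"
         "polymorphism3 V E p" "idempotent3 V p"
         "\<forall>i\<le>n. polymorphism3 V E (e i) \<and> idempotent3 V (e i)"
    and eqs: "\<forall>x\<in>V. \<forall>y\<in>V. \<forall>z\<in>V.
         x = d 0 x y z \<and> e n x y z = z \<and>
         (\<forall>i<n. even i \<longrightarrow> d i x y y = d (Suc i) x y y \<and> e i x y y = e (Suc i) x y y) \<and>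
         (\<forall>i<n. odd i \<longrightarrow> d i x x y = d (Suc i) x x y \<and> e i x x y = e (Suc i) x x y) \<and>
         d n x y y = p x y y \<and> p x x y = e 0 x x y \<and>
         (\<forall>i<n. odd i \<longrightarrow> d i x y x = d (Suc i) x y x) \<and>
         (\<forall>j<n. even j \<longrightarrow> e j x y x = e (Suc j) x y x)"
    using assms unfolding hobby_mckenzie_def by (elim exE conjE) (rule that; assumption)
  note inst = bspec[OF bspec[OF bspec[OF eqs]]]
  have d_0: "d 0 x y z = x" if "x \<in> V" "y \<in> V" "z \<in> V" for x y z
    using inst[OF that, THEN conjunct1] by (rule sym)
  note rest = inst[THEN conjunct2]
  define N where "N = (if even n then n else Suc n)"
  define d' where "d' i = d (min i n)" for i
  define e' where "e' i = e (min i n)" for i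
  have N: "even N" "min N n = n"
    by (simp_all add: N_def)
  \<comment> \<open>Each link of the padded chain is either an original one or joins two copies of
    the last operation.\<close>
  have step: "i < n \<and> min i n = i \<and> min (Suc i) n = Suc i \<or> min i n = n \<and> min (Suc i) n = n" for i
    by auto
  have "hobby_mckenzie_chain V E N d' p e'"
  proof
    fix i x y assume V: "x \<in> V" "y \<in> V"
    show "d' i x y y = d' (Suc i) x y y" "e' i x y y = e' (Suc i) x y y" if "even i"
      using step[of i] rest[OF V V(2)] that unfolding d'_def e'_def by auto
    show "d' i x x y = d' (Suc i) x x y" "e' i x x y = e' (Suc i) x x y" if "odd i"
      using step[of i] rest[OF V V(2)] that unfolding d'_def e'_def by auto
    show "d' i x y x = d' (Suc i) x y x" if "odd i"
      using step[of i] rest[OF V V(2)] that unfolding d'_def by auto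
    show "e' i x y x = e' (Suc i) x y x" if "even i"
      using step[of i] rest[OF V V(2)] that unfolding e'_def by auto
  next
    show "d' 0 x y z = x" if "x \<in> V" "y \<in> V" "z \<in> V" for x y z
      using d_0[OF that] by (simp add: d'_def)
    show "e' N x y z = z" if "x \<in> V" "y \<in> V" "z \<in> V" for x y z
      using rest[OF that] N(2) by (simp add: e'_def)
    show "d' N x y y = p x y y" "p x x y = e' 0 x x y" if "x \<in> V" "y \<in> V" for x y
      using rest[OF that that(2)] N(2) by (simp_all add: d'_def e'_def)
  qed (use N ops in \<open>simp_all add: d'_def e'_def\<close>)
  with N(1) show ?thesis
    by blast
qed

section \<open>Extension of the whole chain\<close>

lemma hobby_mckenzie_extend:
  assumes E: "E \<subseteq> V \<times> V" and HM: "hobby_mckenzie V E"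
  shows "hobby_mckenzie (topbot_V V) (topbot_E V E)"
proof -
  let ?W = "topbot_V V" and ?F = "topbot_E V E"
  obtain n d p e where "hobby_mckenzie_chain V E n d p e" and n: "even n"
    using hobby_mckenzie_even_chain[OF HM] by blast
  then interpret hobby_mckenzie_chain V E n d p e
    by simp
  \<comment> \<open>The two new operations come first, shifting the old indices by two and so
    keeping their parity. In \<open>e'\<close> they come last, so the old indices do not
    move.\<close>
  define d' where "d' i = (case i of 0 \<Rightarrow> (\<lambda>x y z. x) | Suc 0 \<Rightarrow> proj1_unless (absorb3 (d 0))
      | Suc (Suc j) \<Rightarrow> absorb3 (d j))" for i
  define e' where "e' i = (if i \<le> n then absorb3 (e i) else if i = Suc n then proj3_unless (absorb3 (e n))
      else (\<lambda>x y z. z))" for i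
  have d'_simps: "d' 0 = (\<lambda>x y z. x)" "d' (Suc 0) = proj1_unless (absorb3 (d 0))"
    "d' (Suc (Suc j)) = absorb3 (d j)" for j
    by (simp_all add: d'_def)
  have e'_simps: "i \<le> n \<Longrightarrow> e' i = absorb3 (e i)" "e' (Suc n) = proj3_unless (absorb3 (e n))"
    "e' (Suc (Suc n)) = (\<lambda>x y z. z)" for i
    by (simp_all add: e'_def)
  \<comment> \<open>On (x,x,y) and (x,y,x), \<open>proj1_unless\<close> takes its projection branch
    only if x = y, and there idempotence makes both branches equal. The same holds for
    \<open>proj3_unless\<close> on (x,y,y) and (x,y,x).\<close>
  have absorb_d_0: "absorb3 (d 0) x x x = x" and absorb_e_n: "absorb3 (e n) x x x = x" if "x \<in> ?W" for x
    using idempotent3_absorb3[OF d_idem[of 0]] idempotent3_absorb3[OF e_idem[of n]] that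
    by (simp_all add: idempotent3_def)
  \<comment> \<open>A link is one of the two new ones or an old link \<open>j\<close> of the same
    parity.\<close>
  have d_split: "i = 0 \<or> i = Suc 0 \<or> (\<exists>j<n. i = Suc (Suc j) \<and> even j = even i)" if "i < Suc (Suc n)" for i
  proof -
    have "i = 0 \<or> i = Suc 0 \<or> (\<exists>j. i = Suc (Suc j))"
      by presburger
    then show ?thesis
      using that by auto
  qed
  have e_split: "i < n \<or> i = n \<or> i = Suc n" if "i < Suc (Suc n)" for i
    using that by auto
  show ?thesis
    unfolding hobby_mckenzie_def
  proof (intro exI conjI)
    show "\<forall>i\<le>Suc (Suc n). polymorphism3 ?W ?F (d' i) \<and> idempotent3 ?W (d' i)"
    proof (intro allI impI)
      fix i assume "i \<le> Suc (Suc n)"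
      moreover have "i = 0 \<or> i = Suc 0 \<or> (\<exists>j. i = Suc (Suc j))"
        by presburger
      ultimately consider "i = 0" | "i = Suc 0" | j where "i = Suc (Suc j)" "j \<le> n"
        by auto
      then show "polymorphism3 ?W ?F (d' i) \<and> idempotent3 ?W (d' i)"
      proof cases
        case 1
        then show ?thesis
          by (simp add: d'_simps polymorphism3_proj idempotent3_def)
      next
        case 2
        have "polymorphism3 ?W ?F (proj1_unless (absorb3 (d 0)))"
          using E d_poly d_0 by (intro polymorphism3_proj1_unless) auto
        then show ?thesis
          using 2 by (simp add: d'_simps idempotent3_def proj1_unless_def)
      next
        case 3
        then show ?thesis
          by (simp add: d'_simps polymorphism3_absorb3 idempotent3_absorb3 E d_poly d_idem)
      qed
    qed
    show "polymorphism3 ?W ?F (absorb3 p)" "idempotent3 ?W (absorb3 p)"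
      using E p_poly p_idem by (simp_all add: polymorphism3_absorb3 idempotent3_absorb3)
    show "\<forall>i\<le>Suc (Suc n). polymorphism3 ?W ?F (e' i) \<and> idempotent3 ?W (e' i)"
    proof (intro allI impI)
      fix i assume "i \<le> Suc (Suc n)"
      then consider "i \<le> n" | "i = Suc n" | "i = Suc (Suc n)"
        by linarith
      then show "polymorphism3 ?W ?F (e' i) \<and> idempotent3 ?W (e' i)"
      proof cases
        case 1
        then show ?thesis
          by (simp add: e'_simps polymorphism3_absorb3 idempotent3_absorb3 E e_poly e_idem)
      next
        case 2
        have "polymorphism3 ?W ?F (proj3_unless (absorb3 (e n)))"
          using E e_poly e_n by (intro polymorphism3_proj3_unless) auto
        then show ?thesis
          using 2 by (simp add: e'_simps idempotent3_def proj3_unless_def)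
      next
        case 3
        then show ?thesis
          by (simp add: e'_simps polymorphism3_proj idempotent3_def)
      qed
    qed
    show "\<forall>x\<in>?W. \<forall>y\<in>?W. \<forall>z\<in>?W.
         x = d' 0 x y z \<and> e' (Suc (Suc n)) x y z = z \<and>
         (\<forall>i<Suc (Suc n). even i \<longrightarrow> d' i x y y = d' (Suc i) x y y \<and> e' i x y y = e' (Suc i) x y y) \<and>
         (\<forall>i<Suc (Suc n). odd i \<longrightarrow> d' i x x y = d' (Suc i) x x y \<and> e' i x x y = e' (Suc i) x x y) \<and>
         d' (Suc (Suc n)) x y y = absorb3 p x y y \<and> absorb3 p x x y = e' 0 x x y \<and>
         (\<forall>i<Suc (Suc n). odd i \<longrightarrow> d' i x y x = d' (Suc i) x y x) \<and>
         (\<forall>j<Suc (Suc n). even j \<longrightarrow> e' j x y x = e' (Suc j) x y x)"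
    proof (intro ballI conjI allI impI)
      fix x y z assume W: "x \<in> ?W" "y \<in> ?W"
      show "x = d' 0 x y z" "e' (Suc (Suc n)) x y z = z"
        by (simp_all add: d'_simps e'_simps)
      show "d' (Suc (Suc n)) x y y = absorb3 p x y y"
        unfolding d'_simps using W d_p by (intro absorb3_eq_xyy) auto
      have "absorb3 p x x y = absorb3 (e 0) x x y"
        using W p_e by (intro absorb3_eq_xxy) auto
      then show "absorb3 p x x y = e' 0 x x y"
        by (simp add: e'_simps)
      fix i assume i: "i < Suc (Suc n)"
      show "d' i x y y = d' (Suc i) x y y" if "even i"
        using d_split[OF i] that W
        by (auto simp: d'_simps proj1_unless_def intro!: absorb3_eq_xyy[where V = V] d_xyy)
      show "d' i x x y = d' (Suc i) x x y" if "odd i"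
        using d_split[OF i] that W
        by (auto simp: d'_simps proj1_unless_def absorb_d_0 intro!: absorb3_eq_xxy[where V = V] d_xxy)
      show "d' i x y x = d' (Suc i) x y x" if "odd i"
        using d_split[OF i] that W
        by (auto simp: d'_simps proj1_unless_def absorb_d_0 intro!: absorb3_eq_xyx[where V = V] d_xyx)
      \<comment> \<open>Evenness of \<open>n\<close> is decisive for the \<open>e\<close>-chain: the
        link at \<open>n\<close>, from \<open>absorb3 (e n)\<close> to \<open>proj3_unless\<close>,
        must be even, as it fulfils the identities on (x,y,y) and (x,y,x). The link at
        \<open>Suc n\<close>, to the third projection, is then odd and needs agreement on (x,x,y)
        only.\<close>
      show "e' i x y y = e' (Suc i) x y y" if "even i"
        using e_split[OF i] that W n
        by (auto simp: e'_simps proj3_unless_def absorb_e_n intro!: absorb3_eq_xyy[where V = V] e_xyy)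
      show "e' i x x y = e' (Suc i) x x y" if "odd i"
        using e_split[OF i] that W n
        by (auto simp: e'_simps proj3_unless_def intro!: absorb3_eq_xxy[where V = V] e_xxy)
      show "e' i x y x = e' (Suc i) x y x" if "even i"
        using e_split[OF i] that W n
        by (auto simp: e'_simps proj3_unless_def absorb_e_n intro!: absorb3_eq_xyx[where V = V] e_xyx)
    qed
  qed
qed

theorem theorem5p5:
  fixes V :: "'a set" and E :: "('a \<times> 'a) set"
  assumes "digraph V E"
  shows "hobby_mckenzie (topbot_V V) (topbot_E V E) \<longleftrightarrow> hobby_mckenzie V E"
proof -
  have "E \<subseteq> V \<times> V"
    using assms by (simp add: digraph_def)
  then show ?thesis
    using hobby_mckenzie_restrict hobby_mckenzie_extend by blast
qed

end
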